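(* Let $h:\mathbb{R}^4\to\mathbb{R}^4$ be defined by $$h(x_1,x_2,x_3,x_4)=\left(\frac{x_1^2-x_2^2}{\|x\|},\frac{2x_1x_2}{\|x\|},\frac{x_3^2-x_4^2}{\|x\|},\frac{2x_3x_4}{\|x\|}\right)\ \text{ if } x=(x_1,x_2,x_3,x_4)\neq\theta,\qquad h(\theta)=\theta.$$ Let $z=(z_1,z_2,z_3,z_4)\in\mathbb{R}^4\setminus\{\theta\}$. Then: (a) $h$ is Fréchet differentiable at $z$ and $$\nabla h(z)=\begin{pmatrix}\frac{(z_1^2+3z_2^2+2z_3^2+2z_4^2)z_1}{\|z\|^3}&\frac{2z_2^2z_2}{\|z\|^3}&\frac{-(z_3^2-z_4^2)z_1}{\|z\|^3}&\frac{-2z_3z_4z_1}{\|z\|^3}\\ \frac{-(3z_1^2+z_2^2+2z_3^2+2z_4^2)z_2}{\|z\|^3}&\frac{2z_1^2z_1}{\|z\|^3}&\frac{-(z_3^2-z_4^2)z_2}{\|z\|^3}&\frac{-2z_3z_4z_2}{\|z\|^3}\\ \frac{-(z_1^2-z_2^2)z_3}{\|z\|^3}&\frac{-2z_1z_2z_3}{\|z\|^3}&\frac{(2z_1^2+2z_2^2+z_3^2+3z_4^2)z_3}{\|z\|^3}&\frac{2z_4^2z_4}{\|z\|^3}\\ \frac{-(z_1^2-z_2^2)z_4}{\|z\|^3}&\frac{-2z_1z_2z_4}{\|z\|^3}&\frac{-(2z_1^2+2z_2^2+3z_3^2+z_4^2)z_4}{\|z\|^3}&\frac{2z_3^2z_3}{\|z\|^3}\end{pmatrix}.$$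 (b) $h$ is Mordukhovich differentiable at $z$ and $$\widehat{D}^*h(z)=\begin{pmatrix}\frac{(z_1^2+3z_2^2+2z_3^2+2z_4^2)z_1}{\|z\|^3}&\frac{-(3z_1^2+z_2^2+2z_3^2+2z_4^2)z_2}{\|z\|^3}&\frac{-(z_1^2-z_2^2)z_3}{\|z\|^3}&\frac{-(z_1^2-z_2^2)z_4}{\|z\|^3}\\ \frac{2z_2^2z_2}{\|z\|^3}&\frac{2z_1^2z_1}{\|z\|^3}&\frac{-2z_1z_2z_3}{\|z\|^3}&\frac{-2z_1z_2z_4}{\|z\|^3}\\ \frac{-(z_3^2-z_4^2)z_1}{\|z\|^3}&\frac{-(z_3^2-z_4^2)z_2}{\|z\|^3}&\frac{(2z_1^2+2z_2^2+z_3^2+3z_4^2)z_3}{\|z\|^3}&\frac{-(2z_1^2+2z_2^2+3z_3^2+z_4^2)z_4}{\|z\|^3}\\ \frac{-2z_3z_4z_1}{\|z\|^3}&\frac{-2z_3z_4z_2}{\|z\|^3}&\frac{2z_4^2z_4}{\|z\|^3}&\frac{2z_3^2z_3}{\|z\|^3}\end{pmatrix}.$$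
   Context: $\theta$ denotes the origin; $\mathbb{R}^4$ has the Euclidean norm $\|\cdot\|$ and inner product. Vectors are row vectors, and a matrix $A$ represents the linear map $u\mapsto uA$. $h$ is Fréchet differentiable at $z$ with derivative $\nabla h(z)$ (linear) if $\lim_{x\to z}\frac{h(x)-h(z)-\nabla h(z)(x-z)}{\|x-z\|}=\theta$. Mordukhovich derivative: for $y\in\mathbb{R}^4$, $\widehat{D}^*h(z)(y)=\Big\{x\in\mathbb{R}^4:\limsup_{u\to z}\frac{\langle x,u-z\rangle-\langle y,h(u)-h(z)\rangle}{\|u-z\|+\|h(u)-h(z)\|}\le 0\Big\}$ ($h$ is continuous). $h$ is Mordukhovich differentiable at $z$ if this set is nonempty for every $y$. That $\widehat{D}^*h(z)$ equals a matrix $B$ means $\widehat{D}^*h(z)(y)=\{yB\}$ for every $y$.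
   Formalization: The printed entries 2z_2^2z_2, 2z_1^2z_1, 2z_4^2z_4, 2z_3^2z_3 (over ||z||^3), false e.g. at z=(0,1,1,0), become 2(z_2^2+z_3^2+z_4^2)z_2, 2(z_1^2+z_3^2+z_4^2)z_1, 2(z_1^2+z_2^2+z_4^2)z_4, 2(z_1^2+z_2^2+z_3^2)z_3 in both (a) and (b). *)

theory Defs
  imports "HOL-Analysis.Analysis"
begin

text \<open>
  The limit superior is taken in the extended reals.  The denominator vanishes only at
  \<open>u = z\<close>, which the filter \<open>at z\<close> excludes.  Only \<open>u \<rightarrow> z\<close> is required, and not
  also \<open>f u \<rightarrow> f z\<close>, so this is the usual notion only for continuous \<open>f\<close>.
\<close>

definition mordukhovich_derivative ::
    "('a::euclidean_space \<Rightarrow> 'b::euclidean_space) \<Rightarrow> 'a \<Rightarrow> 'b \<Rightarrow> 'a set" where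
  "mordukhovich_derivative f z y =
     {x. Limsup (at z) (\<lambda>u. ereal ((inner x (u - z) - inner y (f u - f z)) /
                                   (norm (u - z) + norm (f u - f z)))) \<le> 0}"

definition mordukhovich_differentiable ::
    "('a::euclidean_space \<Rightarrow> 'b::euclidean_space) \<Rightarrow> 'a \<Rightarrow> bool" where
  "mordukhovich_differentiable f z \<longleftrightarrow> (\<forall>y. mordukhovich_derivative f z y \<noteq> {})"

text \<open>
  Vectors are row vectors, so a matrix \<open>A\<close> stands for \<open>\<lambda>u. u v* A\<close>, and the entry
  \<open>A $ i $ j\<close> of the derivative is the partial derivative of the \<open>j\<close>-th component along
  the \<open>i\<close>-th coordinate.

  The partial derivatives of the second component along the first two coordinates are
  \<open>2 * ((z$2)^2 + (z$3)^2 + (z$4)^2) * z$2 / norm z ^ 3\<close> and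
  \<open>2 * ((z$1)^2 + (z$3)^2 + (z$4)^2) * z$1 / norm z ^ 3\<close>, and similarly for the fourth
  component along the last two.  The source prints these four entries, in the derivative and again
  in its transpose, as \<open>2 * (z$2)^2 * z$2 / norm z ^ 3\<close> and so on, with two of the three
  squares missing; with those entries the claim fails, for instance at \<open>z = (0, 1, 1, 0)\<close>.
  The theorem is stated with the complete entries.
\<close>

definition h4 :: "real^4 \<Rightarrow> real^4" where
  "h4 x = (if x = 0 then 0 else
            vector [((x$1)^2 - (x$2)^2) / norm x,
                    (2 * x$1 * x$2) / norm x,
                    ((x$3)^2 - (x$4)^2) / norm x,
                    (2 * x$3 * x$4) / norm x])"

end

theory Submission
  imports Defs
begin

text \<open>
  Away from the origin each component of \<open>h4\<close> is a quadratic polynomial divided by the norm, so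
  part (a) is the quotient rule.  Part (b) is an instance of a general fact: where a map is
  Frechet differentiable with derivative \<open>f'\<close>, its Mordukhovich derivative at \<open>y\<close> is the singleton
  of \<open>adjoint f' y\<close>.  This vector belongs to the set since then only the first-order remainder
  is left in the numerator; any other \<open>x\<close> is excluded by approaching \<open>z\<close> along
  \<open>w = x - adjoint f' y\<close>, where the quotient tends to
  \<open>inner w w / (norm w + norm (f' w)) > 0\<close>.
\<close>

text \<open>Restricting \<open>f\<close> to the line through \<open>z\<close> in direction
  \<open>w\<close> and applying the chain rule gives the derivative at 0. The result is stated with
  difference quotients because these are what appears when the Mordukhovich quotient is followed
  along a ray.\<close>

lemma tendsto_directional_derivative:
  fixes f :: "'a::real_normed_vector \<Rightarrow> 'b::real_normed_vector"
  assumes "(f has_derivative f') (at z)"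
  shows "((\<lambda>t. (f (z + t *\<^sub>R w) - f z) /\<^sub>R t) \<longlongrightarrow> f' w) (at 0)"
proof -
  interpret bounded_linear f' by (rule has_derivative_bounded_linear[OF assms])
  have "((\<lambda>t. z + t *\<^sub>R w) has_derivative (\<lambda>t. t *\<^sub>R w)) (at 0)"
    by (auto intro!: derivative_eq_intros)
  \<comment> \<open>The base point is written as the value of the line at 0, the form that the chain
    rule expects.\<close>
  moreover have "(f has_derivative f') (at (z + 0 *\<^sub>R w))" using assms by simp
  ultimately have "((\<lambda>t. f (z + t *\<^sub>R w)) has_derivative (\<lambda>t. f' (t *\<^sub>R w))) (at 0)"
    by (rule has_derivative_compose)
  then have lim: "((\<lambda>t. norm (f (z + t *\<^sub>R w) - f z - t *\<^sub>R f' w) / norm t) \<longlongrightarrow> 0) (at 0)"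
    by (simp add: has_derivative_at scaleR)
  have eq: "norm (f (z + t *\<^sub>R w) - f z - t *\<^sub>R f' w) / norm t
      = norm ((f (z + t *\<^sub>R w) - f z) /\<^sub>R t - f' w)" if "t \<noteq> 0" for t
  proof -
    have "(f (z + t *\<^sub>R w) - f z) /\<^sub>R t - f' w = (f (z + t *\<^sub>R w) - f z - t *\<^sub>R f' w) /\<^sub>R t"
      using that by (simp add: scaleR_diff_right)
    then show ?thesis by (simp only: norm_scaleR) (simp add: divide_inverse mult.commute)
  qed
  have "((\<lambda>t. norm ((f (z + t *\<^sub>R w) - f z) /\<^sub>R t - f' w)) \<longlongrightarrow> 0) (at 0)"
    by (rule Lim_transform_eventually[OF lim]) (simp add: eventually_at_filter flip: eq)
  then show ?thesis by (metis LIM_zero_cancel tendsto_norm_zero_cancel)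
qed

lemma mordukhovich_derivative_eq_adjoint:
  fixes f :: "'a::euclidean_space \<Rightarrow> 'b::euclidean_space"
  assumes f': "(f has_derivative f') (at z)"
  shows "mordukhovich_derivative f z y = {adjoint f' y}"
proof -
  interpret f': bounded_linear f' by (rule has_derivative_bounded_linear[OF f'])
  have adj: "inner (adjoint f' y) v = inner y (f' v)" for v
    using adjoint_works[OF f'.linear, of v y] by (simp add: inner_commute)
  define q where "q x u = (inner x (u - z) - inner y (f u - f z)) / (norm (u - z) + norm (f u - f z))"
    for x u
  have "x = adjoint f' y" if "Limsup (at z) (\<lambda>u. ereal (q x u)) \<le> 0" for x
  proof (rule ccontr)
    define w where "w = x - adjoint f' y"
    define L where "L = inner w w / (norm w + norm (f' w))"
    assume "x \<noteq> adjoint f' y"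
    then have w: "w \<noteq> 0" by (simp add: w_def)
    then have L: "L > 0" and den: "norm w + norm (f' w) \<noteq> 0"
      by (auto simp: L_def add_pos_nonneg add_nonneg_eq_0_iff)
    \<comment> \<open>Along the ray, dividing numerator and denominator of \<open>q x\<close> by
      \<open>t > 0\<close> leaves an expression that depends on \<open>t\<close> only through the
      difference quotient \<open>d t\<close>. The one-sided filter allows \<open>t\<close> to be
      taken out of the norms without an absolute value.\<close>
    define d where "d t = (f (z + t *\<^sub>R w) - f z) /\<^sub>R t" for t
    have "(d \<longlongrightarrow> f' w) (at_right 0)"
      using tendsto_directional_derivative[OF f', of w] unfolding d_def
      by (rule filterlim_mono) (simp_all add: at_le)
    then have lim: "((\<lambda>t. (inner x w - inner y (d t)) / (norm w + norm (d t))) \<longlongrightarrow>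
        (inner x w - inner y (f' w)) / (norm w + norm (f' w))) (at_right 0)"
      by (intro tendsto_intros den)
    have num: "inner x w - inner y (f' w) = inner w w"
      by (simp add: w_def inner_diff_left flip: adj)
    have eq: "(inner x w - inner y (d t)) / (norm w + norm (d t)) = q x (z + t *\<^sub>R w)"
      if "t > 0" for t
    proof -
      have "f (z + t *\<^sub>R w) - f z = t *\<^sub>R d t" using that by (simp add: d_def)
      then have "q x (z + t *\<^sub>R w)
          = (t * (inner x w - inner y (d t))) / (t * (norm w + norm (d t)))"
        using that by (simp add: q_def right_diff_distrib distrib_left)
      then show ?thesis using that by simp
    qed
    have "((\<lambda>t. q x (z + t *\<^sub>R w)) \<longlongrightarrow> L) (at_right 0)"
      unfolding L_def
      by (rule Lim_transform_eventually[OF lim[unfolded num]]) (simp add: eventually_at_filter eq)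
    \<comment> \<open>The value \<open>L / 2\<close> lies strictly between 0 and \<open>L\<close>:
      near \<open>z\<close> the bound on the Limsup keeps \<open>q x\<close> below it, while the
      limit \<open>L\<close> keeps \<open>q x\<close> above it on the ray.\<close>
    then have large: "\<forall>\<^sub>F t in at_right 0. q x (z + t *\<^sub>R w) > L / 2"
      by (rule order_tendstoD) (use L in simp)
    have small: "\<forall>\<^sub>F u in at z. q x u < L / 2"
    proof -
      have "Limsup (at z) (\<lambda>u. ereal (q x u)) < ereal (L / 2)"
        using that L by (auto intro: le_less_trans)
      then show ?thesis by (auto dest: Limsup_lessD)
    qed
    \<comment> \<open>The filter \<open>at z\<close> excludes \<open>z\<close> itself, so the ray
      must avoid its starting point; this is where \<open>w \<noteq> 0\<close> enters.\<close>
    have approach: "filterlim (\<lambda>t. z + t *\<^sub>R w) (at z) (at_right 0)"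
    proof (rule filterlim_atI)
      show "((\<lambda>t. z + t *\<^sub>R w) \<longlongrightarrow> z) (at_right 0)"
        by (auto intro!: tendsto_eq_intros)
      show "\<forall>\<^sub>F t in at_right 0. z + t *\<^sub>R w \<noteq> z"
        using w by (auto simp: eventually_at_filter)
    qed
    \<comment> \<open>Both bounds hold for all small \<open>t > 0\<close>, and such \<open>t\<close>
      exist because \<open>at_right 0\<close> is a nontrivial filter.\<close>
    have "\<forall>\<^sub>F t in at_right (0::real). False"
      using large eventually_compose_filterlim[OF small approach] by eventually_elim simp
    then show False by simp
  qed
  moreover have "Limsup (at z) (\<lambda>u. ereal (q (adjoint f' y) u)) \<le> 0"
  proof -
    have "((\<lambda>u. q (adjoint f' y) u) \<longlongrightarrow> 0) (at z)"
    proof (rule Lim_null_comparison)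
      have "((\<lambda>u. norm (f u - f z - f' (u - z)) / norm (u - z)) \<longlongrightarrow> 0) (at z)"
        using f' by (simp add: has_derivative_iff_norm)
      then show "((\<lambda>u. norm y * (norm (f u - f z - f' (u - z)) / norm (u - z))) \<longlongrightarrow> 0) (at z)"
        by (rule tendsto_mult_right_zero)
      have "norm (q (adjoint f' y) u) \<le> norm y * (norm (f u - f z - f' (u - z)) / norm (u - z))"
        if "u \<noteq> z" for u
      proof -
        have "q (adjoint f' y) u
            = - inner y (f u - f z - f' (u - z)) / (norm (u - z) + norm (f u - f z))"
          unfolding q_def adj by (simp add: inner_diff_right)
        then have "norm (q (adjoint f' y) u)
            = \<bar>inner y (f u - f z - f' (u - z))\<bar> / (norm (u - z) + norm (f u - f z))"
          by simp
        \<comment> \<open>Cauchy-Schwarz bounds the numerator, and dropping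
          \<open>norm (f u - f z)\<close> only shrinks the denominator, which stays positive since
          \<open>u \<noteq> z\<close>.\<close>
        also have "\<dots> \<le> (norm y * norm (f u - f z - f' (u - z))) / norm (u - z)"
          by (rule frac_le) (use that in \<open>auto intro: Cauchy_Schwarz_ineq2\<close>)
        finally show ?thesis by simp
      qed
      then show "\<forall>\<^sub>F u in at z. norm (q (adjoint f' y) u)
          \<le> norm y * (norm (f u - f z - f' (u - z)) / norm (u - z))"
        by (auto simp: eventually_at_filter)
    qed
    then have "((\<lambda>u. ereal (q (adjoint f' y) u)) \<longlongrightarrow> ereal 0) (at z)"
      by (rule tendsto_ereal)
    \<comment> \<open>A Euclidean space has no isolated points, so \<open>at z\<close> is nontrivial
      and the Limsup equals the limit.\<close>
    then show ?thesis by (subst lim_imp_Limsup) (auto simp: zero_ereal_def)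
  qed
  ultimately show ?thesis
    unfolding mordukhovich_derivative_def q_def[symmetric] by blast
qed

text \<open>In the row-vector convention \<open>inner (u v* A) y = inner u (A *v y)\<close>, and
  \<open>A *v y\<close> is \<open>y v* transpose A\<close>; hence transposition represents the
  adjoint.\<close>

lemma mordukhovich_derivative_eq_matrix:
  fixes f :: "real^'n \<Rightarrow> real^'m"
  assumes "(f has_derivative (\<lambda>u. u v* A)) (at z)"
  shows "mordukhovich_derivative f z y = {y v* transpose A}"
proof -
  have "adjoint (\<lambda>u. u v* A) = (\<lambda>y. y v* transpose A)"
    by (rule adjoint_unique) (simp add: dot_lmul_matrix)
  then show ?thesis using mordukhovich_derivative_eq_adjoint[OF assms] by simp
qed

lemma has_derivative_vec_componentwise:
  fixes f :: "'a::real_normed_vector \<Rightarrow> real^'n"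
  assumes "\<And>i. ((\<lambda>x. f x $ i) has_derivative (\<lambda>u. f' u $ i)) (at z within S)"
  shows "(f has_derivative f') (at z within S)"
  using assms
  by (subst has_derivative_componentwise_within) (auto simp: Basis_vec_def inner_axis)

lemma vector_4 [simp]:
  fixes a b c d :: "'a::zero"
  shows "(vector [a, b, c, d] :: 'a^4) $ 1 = a" "(vector [a, b, c, d] :: 'a^4) $ 2 = b"
    "(vector [a, b, c, d] :: 'a^4) $ 3 = c" "(vector [a, b, c, d] :: 'a^4) $ 4 = d"
  unfolding vector_def by simp_all

text \<open>At the origin the quotients have the value \<open>0\<close>, so \<open>h4\<close> needs no case distinction.\<close>

lemma h4_nth:
  "h4 x $ 1 = ((x$1)\<^sup>2 - (x$2)\<^sup>2) / norm x" "h4 x $ 2 = (2 * x$1 * x$2) / norm x"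
  "h4 x $ 3 = ((x$3)\<^sup>2 - (x$4)\<^sup>2) / norm x" "h4 x $ 4 = (2 * x$3 * x$4) / norm x"
  by (simp_all add: h4_def)

lemma norm_vec4_squared: "(norm (z::real^4))\<^sup>2 = (z$1)\<^sup>2 + (z$2)\<^sup>2 + (z$3)\<^sup>2 + (z$4)\<^sup>2"
  by (simp add: norm_vec_def L2_set_def sum_4)

text \<open>The derivative of the norm at \<open>z\<close> is the inner product with
  \<open>z / norm z\<close>. Over the common denominator \<open>norm z ^ 3\<close> the norm enters
  the numerator only squared, so for polynomial \<open>p\<close> the numerator is polynomial in the
  coordinates of \<open>z\<close> and \<open>u\<close>.\<close>

lemma has_derivative_divide_norm:
  fixes p :: "'a::real_inner \<Rightarrow> real"
  assumes "(p has_derivative p') (at z)" and "z \<noteq> 0"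
  shows "((\<lambda>x. p x / norm x) has_derivative
    (\<lambda>u. ((norm z)\<^sup>2 * p' u - p z * inner u z) / norm z ^ 3)) (at z)"
proof -
  have "(norm has_derivative (\<lambda>u. inner u (sgn z))) (at z)"
    by (rule has_derivative_norm[OF assms(2)])
  from has_derivative_divide[OF assms(1) this] assms(2)
  have "((\<lambda>x. p x / norm x) has_derivative
    (\<lambda>u. - p z * (inverse (norm z) * inner u (sgn z) * inverse (norm z)) + p' u / norm z)) (at z)"
    by simp
  then show ?thesis
    by (rule has_derivative_eq_rhs)
      (use assms(2) in \<open>auto simp: sgn_div_norm field_simps power2_eq_square power3_eq_cube\<close>)
qed

lemma has_derivative_square_diff_nth:
  "((\<lambda>x::real^'n. (x$i)\<^sup>2 - (x$j)\<^sup>2) has_derivative (\<lambda>u. 2 * z$i * u$i - 2 * z$j * u$j)) (at z)"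
  by (auto intro!: derivative_eq_intros bounded_linear.has_derivative[OF bounded_linear_vec_nth])

lemma has_derivative_double_product_nth:
  "((\<lambda>x::real^'n. 2 * x$i * x$j) has_derivative (\<lambda>u. 2 * z$i * u$j + 2 * z$j * u$i)) (at z)"
  by (auto intro!: derivative_eq_intros bounded_linear.has_derivative[OF bounded_linear_vec_nth])

theorem theorem5p15:
  fixes z :: "real^4"
  assumes "z \<noteq> 0"
  shows "(h4 has_derivative (\<lambda>u. u v* (vector [
          vector [(((z$1)^2 + 3 * (z$2)^2 + 2 * (z$3)^2 + 2 * (z$4)^2) * z$1) / norm z ^ 3,
                  (2 * ((z$2)^2 + (z$3)^2 + (z$4)^2) * z$2) / norm z ^ 3,
                  (- ((z$3)^2 - (z$4)^2) * z$1) / norm z ^ 3,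
                  (- 2 * z$3 * z$4 * z$1) / norm z ^ 3],
          vector [(- (3 * (z$1)^2 + (z$2)^2 + 2 * (z$3)^2 + 2 * (z$4)^2) * z$2) / norm z ^ 3,
                  (2 * ((z$1)^2 + (z$3)^2 + (z$4)^2) * z$1) / norm z ^ 3,
                  (- ((z$3)^2 - (z$4)^2) * z$2) / norm z ^ 3,
                  (- 2 * z$3 * z$4 * z$2) / norm z ^ 3],
          vector [(- ((z$1)^2 - (z$2)^2) * z$3) / norm z ^ 3,
                  (- 2 * z$1 * z$2 * z$3) / norm z ^ 3,
                  ((2 * (z$1)^2 + 2 * (z$2)^2 + (z$3)^2 + 3 * (z$4)^2) * z$3) / norm z ^ 3,
                  (2 * ((z$1)^2 + (z$2)^2 + (z$4)^2) * z$4) / norm z ^ 3],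
          vector [(- ((z$1)^2 - (z$2)^2) * z$4) / norm z ^ 3,
                  (- 2 * z$1 * z$2 * z$4) / norm z ^ 3,
                  (- (2 * (z$1)^2 + 2 * (z$2)^2 + 3 * (z$3)^2 + (z$4)^2) * z$4) / norm z ^ 3,
                  (2 * ((z$1)^2 + (z$2)^2 + (z$3)^2) * z$3) / norm z ^ 3]] :: real^4^4))) (at z) \<and>
    mordukhovich_differentiable h4 z \<and>
    (\<forall>y. mordukhovich_derivative h4 z y = {y v* (vector [
          vector [(((z$1)^2 + 3 * (z$2)^2 + 2 * (z$3)^2 + 2 * (z$4)^2) * z$1) / norm z ^ 3,
                  (- (3 * (z$1)^2 + (z$2)^2 + 2 * (z$3)^2 + 2 * (z$4)^2) * z$2) / norm z ^ 3,
                  (- ((z$1)^2 - (z$2)^2) * z$3) / norm z ^ 3,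
                  (- ((z$1)^2 - (z$2)^2) * z$4) / norm z ^ 3],
          vector [(2 * ((z$2)^2 + (z$3)^2 + (z$4)^2) * z$2) / norm z ^ 3,
                  (2 * ((z$1)^2 + (z$3)^2 + (z$4)^2) * z$1) / norm z ^ 3,
                  (- 2 * z$1 * z$2 * z$3) / norm z ^ 3,
                  (- 2 * z$1 * z$2 * z$4) / norm z ^ 3],
          vector [(- ((z$3)^2 - (z$4)^2) * z$1) / norm z ^ 3,
                  (- ((z$3)^2 - (z$4)^2) * z$2) / norm z ^ 3,
                  ((2 * (z$1)^2 + 2 * (z$2)^2 + (z$3)^2 + 3 * (z$4)^2) * z$3) / norm z ^ 3,
                  (- (2 * (z$1)^2 + 2 * (z$2)^2 + 3 * (z$3)^2 + (z$4)^2) * z$4) / norm z ^ 3],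
          vector [(- 2 * z$3 * z$4 * z$1) / norm z ^ 3,
                  (- 2 * z$3 * z$4 * z$2) / norm z ^ 3,
                  (2 * ((z$1)^2 + (z$2)^2 + (z$4)^2) * z$4) / norm z ^ 3,
                  (2 * ((z$1)^2 + (z$2)^2 + (z$3)^2) * z$3) / norm z ^ 3]] :: real^4^4)})"
proof -
  let ?A = "(vector [
          vector [(((z$1)^2 + 3 * (z$2)^2 + 2 * (z$3)^2 + 2 * (z$4)^2) * z$1) / norm z ^ 3,
                  (2 * ((z$2)^2 + (z$3)^2 + (z$4)^2) * z$2) / norm z ^ 3,
                  (- ((z$3)^2 - (z$4)^2) * z$1) / norm z ^ 3,
                  (- 2 * z$3 * z$4 * z$1) / norm z ^ 3],
          vector [(- (3 * (z$1)^2 + (z$2)^2 + 2 * (z$3)^2 + 2 * (z$4)^2) * z$2) / norm z ^ 3,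
                  (2 * ((z$1)^2 + (z$3)^2 + (z$4)^2) * z$1) / norm z ^ 3,
                  (- ((z$3)^2 - (z$4)^2) * z$2) / norm z ^ 3,
                  (- 2 * z$3 * z$4 * z$2) / norm z ^ 3],
          vector [(- ((z$1)^2 - (z$2)^2) * z$3) / norm z ^ 3,
                  (- 2 * z$1 * z$2 * z$3) / norm z ^ 3,
                  ((2 * (z$1)^2 + 2 * (z$2)^2 + (z$3)^2 + 3 * (z$4)^2) * z$3) / norm z ^ 3,
                  (2 * ((z$1)^2 + (z$2)^2 + (z$4)^2) * z$4) / norm z ^ 3],
          vector [(- ((z$1)^2 - (z$2)^2) * z$4) / norm z ^ 3,
                  (- 2 * z$1 * z$2 * z$4) / norm z ^ 3,
                  (- (2 * (z$1)^2 + 2 * (z$2)^2 + 3 * (z$3)^2 + (z$4)^2) * z$4) / norm z ^ 3,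
                  (2 * ((z$1)^2 + (z$2)^2 + (z$3)^2) * z$3) / norm z ^ 3]] :: real^4^4)"
  let ?B = "(vector [
          vector [(((z$1)^2 + 3 * (z$2)^2 + 2 * (z$3)^2 + 2 * (z$4)^2) * z$1) / norm z ^ 3,
                  (- (3 * (z$1)^2 + (z$2)^2 + 2 * (z$3)^2 + 2 * (z$4)^2) * z$2) / norm z ^ 3,
                  (- ((z$1)^2 - (z$2)^2) * z$3) / norm z ^ 3,
                  (- ((z$1)^2 - (z$2)^2) * z$4) / norm z ^ 3],
          vector [(2 * ((z$2)^2 + (z$3)^2 + (z$4)^2) * z$2) / norm z ^ 3,
                  (2 * ((z$1)^2 + (z$3)^2 + (z$4)^2) * z$1) / norm z ^ 3,
                  (- 2 * z$1 * z$2 * z$3) / norm z ^ 3,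
                  (- 2 * z$1 * z$2 * z$4) / norm z ^ 3],
          vector [(- ((z$3)^2 - (z$4)^2) * z$1) / norm z ^ 3,
                  (- ((z$3)^2 - (z$4)^2) * z$2) / norm z ^ 3,
                  ((2 * (z$1)^2 + 2 * (z$2)^2 + (z$3)^2 + 3 * (z$4)^2) * z$3) / norm z ^ 3,
                  (- (2 * (z$1)^2 + 2 * (z$2)^2 + 3 * (z$3)^2 + (z$4)^2) * z$4) / norm z ^ 3],
          vector [(- 2 * z$3 * z$4 * z$1) / norm z ^ 3,
                  (- 2 * z$3 * z$4 * z$2) / norm z ^ 3,
                  (2 * ((z$1)^2 + (z$2)^2 + (z$4)^2) * z$4) / norm z ^ 3,
                  (2 * ((z$1)^2 + (z$2)^2 + (z$3)^2) * z$3) / norm z ^ 3]] :: real^4^4)"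
  have deriv: "(h4 has_derivative (\<lambda>u. u v* ?A)) (at z)"
  proof (rule has_derivative_vec_componentwise)
    note sq = has_derivative_divide_norm[OF has_derivative_square_diff_nth assms]
    note prd = has_derivative_divide_norm[OF has_derivative_double_product_nth assms]
    have "\<forall>i. ((\<lambda>x. h4 x $ i) has_derivative (\<lambda>u. (u v* ?A) $ i)) (at z)"
      unfolding forall_4 h4_nth
      \<comment> \<open>For each component both sides become a fraction over
        \<open>norm z ^ 3\<close>. With the squared norm expanded into coordinates, equality of the
        numerators is a polynomial identity, which \<open>algebra\<close> decides.\<close>
      by (intro conjI; (rule has_derivative_eq_rhs, rule sq prd, rule ext,
        simp only: vector_matrix_mult_def vec_lambda_beta sum_4 vector_4 inner_vec_def
          inner_real_def norm_vec4_squared times_divide_eq_left times_divide_eq_right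
          add_divide_distrib[symmetric],
        rule arg_cong[where f = "\<lambda>s. s / norm z ^ 3"], algebra))
    then show "((\<lambda>x. h4 x $ i) has_derivative (\<lambda>u. (u v* ?A) $ i)) (at z)" for i
      by blast
  qed
  \<comment> \<open>The entries of \<open>?B\<close> are written exactly as the mirrored entries of
    \<open>?A\<close>, so the comparison involves no arithmetic.\<close>
  have transpose: "transpose ?A = ?B"
    by (simp only: vec_eq_iff forall_4 transpose_def vec_lambda_beta vector_4 simp_thms)
  have "mordukhovich_derivative h4 z y = {y v* ?B}" for y
    using mordukhovich_derivative_eq_matrix[OF deriv] unfolding transpose .
  with deriv show ?thesis
    unfolding mordukhovich_differentiable_def by blast
qed

end
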